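(* Every $1$-speed online algorithm for broadcast scheduling to minimize the maximum delay factor is $\Omega(n)$-competitive, where $n$ is the number of unit-sized pages; that is, there is an absolute constant $C>0$ such that for every (sufficiently large) $n$ and every online algorithm $A$ using a speed-$1$ machine, there is a request sequence over $n$ unit-sized pages on which the delay factor of $A$ is at least $Cn$ times the optimal offline delay factor.
   Context: Broadcast scheduling (pull model): there are $n$ distinct pages, each of unit size; requests arrive online, the $i$-th request for page $p$, $J_{(p,i)}$, having arrival time $a_{(p,i)}$ and deadline $d_{(p,i)}$. A single transmission of page $p$ satisfies all outstanding requests for $p$ that arrived before it; the finish time $f_{(p,i)}$ is the earliest time after $a_{(p,i)}$ at which page $p$ is completely transmitted. The delay factor of a schedule on $\sigma$ is $\max\{1,\max_{(p,i)}\frac{f_{(p,i)}-a_{(p,i)}}{d_{(p,i)}-a_{(p,i)}}\}$. The optimal offline schedule also uses a speed-$1$ machine. *)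

theory Defs
  imports "HOL-Analysis.Analysis"
begin

text \<open>The pages are the numbers below \<open>n\<close>. A finite request sequence lists the requests for all
  pages in order of arrival; \<open>J\<^sub>(\<^sub>p\<^sub>,\<^sub>i\<^sub>)\<close> is the \<open>i\<close>-th entry whose page is \<open>p\<close>.\<close>

record request =
  page :: nat
  arrival :: real
  deadline :: real

definition request_sequence :: "nat \<Rightarrow> request list \<Rightarrow> bool" where
  "request_sequence n \<sigma> \<longleftrightarrow>
     sorted_wrt (\<lambda>r r'. arrival r \<le> arrival r') \<sigma> \<and>
     (\<forall>r\<in>set \<sigma>. page r < n \<and> 0 \<le> arrival r \<and> arrival r < deadline r)"

text \<open>\<open>S t = Some (p, k)\<close>: at time \<open>t\<close> the machine is working on the transmission of page \<open>p\<close>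
  labelled \<open>k\<close>; \<open>S t = None\<close>: it is idle. The labels separate different transmissions of the same
  page. A transmission on a speed-1 machine is complete once it has received one unit of time.\<close>

type_synonym schedule = "real \<Rightarrow> (nat \<times> nat) option"

definition airtime :: "schedule \<Rightarrow> nat \<Rightarrow> nat \<Rightarrow> real set" where
  "airtime S p k = {t. S t = Some (p, k)}"

text \<open>Preemption is allowed in \<open>schedules\<close>: a transmission may be interrupted, resumed later, or
  abandoned.\<close>

definition schedules :: "nat \<Rightarrow> schedule set" where
  "schedules n =
     {S. (\<forall>t<0. S t = None) \<and>
         (\<forall>t p k. S t = Some (p, k) \<longrightarrow> p < n) \<and>
         (\<forall>p k. airtime S p k \<in> sets lebesgue)}"

definition nonpreemptive_schedules :: "nat \<Rightarrow> schedule set" where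
  "nonpreemptive_schedules n =
     {S \<in> schedules n. \<forall>p k. airtime S p k = {} \<or> (\<exists>s. airtime S p k = {s..<s + 1})}"

text \<open>Only a transmission that starts no earlier than the arrival of a request can satisfy it.\<close>

definition satisfied_by :: "schedule \<Rightarrow> request \<Rightarrow> real \<Rightarrow> bool" where
  "satisfied_by S r c \<longleftrightarrow>
     (\<exists>k. airtime S (page r) k \<subseteq> {arrival r..} \<and>
          1 \<le> emeasure lebesgue (airtime S (page r) k \<inter> {..c}))"

text \<open>The finish time is \<open>\<infinity>\<close> for a request that is never satisfied.\<close>

definition finish_time :: "schedule \<Rightarrow> request \<Rightarrow> ereal" where
  "finish_time S r = Inf (ereal ` {c. satisfied_by S r c})"

definition delay_factor :: "request list \<Rightarrow> schedule \<Rightarrow> ereal" where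
  "delay_factor \<sigma> S =
     Max (insert 1 ((\<lambda>r. (finish_time S r - ereal (arrival r)) / ereal (deadline r - arrival r))
                      ` set \<sigma>))"

definition optimal_delay_factor :: "schedule set \<Rightarrow> request list \<Rightarrow> ereal" where
  "optimal_delay_factor \<S> \<sigma> = (INF S\<in>\<S>. delay_factor \<sigma> S)"

text \<open>A (deterministic) online algorithm with schedules in \<open>\<S>\<close>: what the machine does up to time
  \<open>t\<close> is determined by the requests that have arrived by time \<open>t\<close>.\<close>

definition online_algorithm ::
    "nat \<Rightarrow> schedule set \<Rightarrow> (request list \<Rightarrow> schedule) \<Rightarrow> bool" where
  "online_algorithm n \<S> A \<longleftrightarrow>
     (\<forall>\<sigma>. request_sequence n \<sigma> \<longrightarrow> A \<sigma> \<in> \<S>) \<and>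
     (\<forall>\<sigma> \<sigma>' t. request_sequence n \<sigma> \<longrightarrow> request_sequence n \<sigma>' \<longrightarrow>
        filter (\<lambda>r. arrival r \<le> t) \<sigma> = filter (\<lambda>r. arrival r \<le> t) \<sigma>' \<longrightarrow>
        (\<forall>u\<le>t. A \<sigma> u = A \<sigma>' u))"

end

theory Submission
  imports Defs
begin

text \<open>
  Let \<open>m = 2 h\<close> with \<open>4 h \<le> n\<close>. At time \<open>0\<close> the adversary requests the pages below \<open>m\<close>, with slack
  \<open>m\<close>. They split into two halves; on one of them the algorithm spends at most \<open>h / 2\<close> units of time
  before time \<open>h\<close>. At time \<open>h\<close> the other half is requested again, so that the work done on it is
  wasted: at least \<open>3 h / 2\<close> units of work remain, whereas an offline schedule that starts with the
  neglected half has only \<open>h\<close> units left. From time \<open>m\<close> on, \<open>m\<close> further pages are requested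
  cyclically, one per unit of time and with slack \<open>1\<close>. The offline schedule serves them all at once
  and has delay factor \<open>1\<close>. If the algorithm had a delay factor below \<open>h / 4\<close>, it could not serve two
  requests of the stream by one transmission, so it would never get rid of its surplus of \<open>h / 2\<close>
  units of work; after \<open>m\<^sup>2\<close> requests of the stream this is a contradiction.
\<close>

section \<open>Airtime per page and its link to the delay factor\<close>

lemma lmeasurable_atLeastLessThan [simp]: "{a..<b :: real} \<in> lmeasurable"
  by (rule bounded_set_imp_lmeasurable) (auto intro: bounded_subset[OF bounded_closed_interval[of a b]])

text \<open>Forgetting the labels gives sets that are disjoint for different pages. The lower bound
  counts only their measure, so preempted or abandoned transmissions need no separate
  treatment.\<close>

definition page_airtime :: "schedule \<Rightarrow> nat \<Rightarrow> real set" where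
  "page_airtime S p = {t. \<exists>k. S t = Some (p, k)}"

lemma page_airtime_eq_Union: "page_airtime S p = (\<Union>k. airtime S p k)"
  by (auto simp: page_airtime_def airtime_def)

lemma page_airtime_measurable:
  assumes "S \<in> schedules n"
  shows "page_airtime S p \<in> sets lebesgue"
  using assms unfolding page_airtime_eq_Union schedules_def by auto

lemma page_airtime_disjoint: "p \<noteq> q \<Longrightarrow> page_airtime S p \<inter> page_airtime S q = {}"
  by (auto simp: page_airtime_def)

lemma page_airtime_interval_lmeasurable:
  assumes "S \<in> schedules n"
  shows "page_airtime S p \<inter> {a..<b} \<in> lmeasurable"
  using page_airtime_measurable[OF assms] by (simp add: fmeasurable_Int_fmeasurable Int_commute)

text \<open>The transmission that satisfies \<open>r\<close> starts no earlier than its arrival. As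
  \<open>delay\<close> is strict, the infimum defining the finish time is undercut by an actual
  completion time before \<open>b\<close>, so a whole unit of airtime lies in the window.\<close>

lemma airtime_of_satisfied_request:
  assumes S: "S \<in> schedules n" and r: "r \<in> set \<sigma>" and slack: "arrival r < deadline r"
    and delay: "delay_factor \<sigma> S < ereal D"
    and late: "arrival r + D * (deadline r - arrival r) \<le> b"
  shows "1 \<le> measure lebesgue (page_airtime S (page r) \<inter> {arrival r..<b})"
proof -
  let ?w = "deadline r - arrival r"
  have "(finish_time S r - ereal (arrival r)) / ereal ?w \<le> delay_factor \<sigma> S"
    unfolding delay_factor_def using r by (intro Max_ge) auto
  then have "(finish_time S r - ereal (arrival r)) / ereal ?w < ereal D"
    using delay by (rule le_less_trans)
  then have "finish_time S r - ereal (arrival r) < ereal (D * ?w)"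
    using slack by (cases "finish_time S r") (auto simp: field_simps)
  then have "finish_time S r < ereal (arrival r + D * ?w)"
    by (cases "finish_time S r") auto
  then obtain c where c: "satisfied_by S r c" "c < arrival r + D * ?w"
    unfolding finish_time_def by (auto simp: Inf_less_iff)
  from c(1) obtain k where k: "airtime S (page r) k \<subseteq> {arrival r..}"
    "1 \<le> emeasure lebesgue (airtime S (page r) k \<inter> {..c})"
    unfolding satisfied_by_def by auto
  let ?X = "page_airtime S (page r) \<inter> {arrival r..<b}"
  have X: "?X \<in> lmeasurable" by (rule page_airtime_interval_lmeasurable[OF S])
  have "airtime S (page r) k \<inter> {..c} \<subseteq> ?X"
    using k(1) c(2) late by (fastforce simp: page_airtime_eq_Union)
  then have "1 \<le> emeasure lebesgue ?X"
    using k(2) X by (meson emeasure_mono fmeasurableD order_trans)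
  then show ?thesis
    using X by (simp add: emeasure_eq_measure2)
qed

lemma delay_factor_le_1:
  assumes "\<And>r. r \<in> set \<sigma> \<Longrightarrow> arrival r < deadline r \<and> satisfied_by S r (deadline r)"
  shows "delay_factor \<sigma> S \<le> 1"
proof -
  have "(finish_time S r - ereal (arrival r)) / ereal (deadline r - arrival r) \<le> 1"
    if "r \<in> set \<sigma>" for r
  proof -
    have "finish_time S r \<le> ereal (deadline r)"
      unfolding finish_time_def using assms[OF that] by (auto intro: Inf_lower)
    then show ?thesis
      using assms[OF that] by (cases "finish_time S r") (auto simp: field_simps one_ereal_def)
  qed
  then show ?thesis
    unfolding delay_factor_def by auto
qed

section \<open>Offline schedules made of unit slots\<close>

text \<open>The slot number serves as the label: every transmission is then a single unit interval,
  and the schedule lies in both classes of schedules.\<close>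

definition slotted_schedule :: "nat \<Rightarrow> (nat \<Rightarrow> nat) \<Rightarrow> schedule" where
  "slotted_schedule N q t =
     (if 0 \<le> t \<and> t < real N then Some (q (nat \<lfloor>t\<rfloor>), nat \<lfloor>t\<rfloor>) else None)"

lemma airtime_slotted_schedule:
  "airtime (slotted_schedule N q) p k = (if k < N \<and> q k = p then {real k..<real k + 1} else {})"
proof -
  have slot: "nat \<lfloor>t\<rfloor> = k \<longleftrightarrow> real k \<le> t \<and> t < real k + 1" if "0 \<le> t" for t
    using that by (auto simp: nat_eq_iff floor_eq_iff)
  have range: "0 \<le> t \<and> t < real N" if "real k \<le> t" "t < real k + 1" "k < N" for t
    using that by linarith
  show ?thesis
  proof (intro set_eqI iffI)
    fix t assume "t \<in> airtime (slotted_schedule N q) p k"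
    then have "0 \<le> t" "t < real N" "q k = p" "nat \<lfloor>t\<rfloor> = k"
      by (auto simp: airtime_def slotted_schedule_def split: if_splits)
    moreover from this have "real k \<le> t" "t < real k + 1"
      using slot by blast+
    ultimately show "t \<in> (if k < N \<and> q k = p then {real k..<real k + 1} else {})"
      by simp
  next
    fix t assume "t \<in> (if k < N \<and> q k = p then {real k..<real k + 1} else {})"
    then have t: "k < N" "q k = p" "real k \<le> t" "t < real k + 1"
      by (auto split: if_splits)
    then have "0 \<le> t \<and> t < real N" "nat \<lfloor>t\<rfloor> = k"
      using range slot by blast+
    then show "t \<in> airtime (slotted_schedule N q) p k"
      using t(2) by (simp add: airtime_def slotted_schedule_def)
  qed
qed

lemma slotted_schedule_nonpreemptive:
  assumes "\<And>k. k < N \<Longrightarrow> q k < n"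
  shows "slotted_schedule N q \<in> nonpreemptive_schedules n"
proof -
  have "p < n" if "slotted_schedule N q t = Some (p, k)" for t p k
  proof -
    have "airtime (slotted_schedule N q) p k \<noteq> {}"
      using that by (auto simp: airtime_def)
    then show ?thesis
      using assms by (auto simp: airtime_slotted_schedule split: if_splits)
  qed
  moreover have "slotted_schedule N q t = None" if "t < 0" for t
    using that by (simp add: slotted_schedule_def)
  ultimately show ?thesis
    unfolding nonpreemptive_schedules_def schedules_def
    by (auto simp: airtime_slotted_schedule)
qed

lemma satisfied_by_slotted_schedule:
  assumes "k < N" "q k = page r" "arrival r \<le> real k" "real k + 1 \<le> c"
  shows "satisfied_by (slotted_schedule N q) r c"
proof -
  have "{real k..<real k + 1} \<inter> {..c} = {real k..<real k + 1}"
    using assms(4) by auto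
  then show ?thesis
    unfolding satisfied_by_def using assms
    by (intro exI[of _ k]) (auto simp: airtime_slotted_schedule)
qed

section \<open>The adversary's requests\<close>

definition initial_requests :: "nat \<Rightarrow> request list" where
  "initial_requests h =
     map (\<lambda>p. \<lparr>page = p, arrival = 0, deadline = 2 * real h\<rparr>) [0..<2 * h]"

definition repeated_requests :: "nat \<Rightarrow> nat \<Rightarrow> request list" where
  "repeated_requests h b =
     map (\<lambda>p. \<lparr>page = p, arrival = real h, deadline = 3 * real h\<rparr>) [b..<b + h]"

definition stream_requests :: "nat \<Rightarrow> request list" where
  "stream_requests h =
     map (\<lambda>i. \<lparr>page = 2 * h + i mod (2 * h), arrival = real i, deadline = real i + 1\<rparr>)
       [2 * h..<2 * h + 2 * h * (2 * h)]"

definition adversary :: "nat \<Rightarrow> nat \<Rightarrow> request list" where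
  "adversary h b = initial_requests h @ repeated_requests h b @ stream_requests h"

lemmas adversary_defs =
  adversary_def initial_requests_def repeated_requests_def stream_requests_def

lemma request_sequence_initial_requests:
  assumes "4 * h \<le> n"
  shows "request_sequence n (initial_requests h)"
  using assms unfolding request_sequence_def initial_requests_def
  by (auto simp: sorted_wrt_map sorted_wrt_upt)

lemma request_sequence_adversary:
  assumes "4 * h \<le> n" "0 < h" "b + h \<le> 2 * h"
  shows "request_sequence n (adversary h b)"
proof -
  have "2 * h + i mod (2 * h) < n" for i
    using assms mod_less_divisor[of "2 * h" i] by linarith
  moreover have "sorted_wrt (\<lambda>i j. real i \<le> real j) [a..<c]" for a c
    using sorted_upt[of a c] by (simp)
  ultimately show ?thesis
    using assms unfolding request_sequence_def adversary_defs
    by (auto simp: sorted_wrt_append sorted_wrt_map)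
qed

text \<open>Strictly before time \<open>h\<close> nothing reveals which half will be repeated; at
  \<open>h\<close> itself the repetition is already visible.\<close>

lemma filter_adversary:
  assumes "t < real h"
  shows "filter (\<lambda>r. arrival r \<le> t) (adversary h b) =
    filter (\<lambda>r. arrival r \<le> t) (initial_requests h)"
  using assms unfolding adversary_def
  by (auto simp: filter_empty_conv repeated_requests_def stream_requests_def)

section \<open>The offline optimum\<close>

lemma optimal_delay_factor_adversary:
  assumes "4 * h \<le> n" "0 < h" "b = 0 \<or> b = h" "nonpreemptive_schedules n \<subseteq> \<S>"
  shows "optimal_delay_factor \<S> (adversary h b) \<le> 1"
proof -
  define N where "N = 2 * h + 2 * h * (2 * h)"
  \<comment> \<open>As \<open>b\<close> is \<open>0\<close> or \<open>h\<close>, the half that is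
    not repeated starts at \<open>h - b\<close> and is sent first. The repeated half follows from
    time \<open>h\<close> on, so one transmission answers both its requests; each stream page is
    sent on arrival.\<close>
  define q where "q k = (if k < h then h - b + k else if k < 2 * h then b + (k - h)
    else 2 * h + k mod (2 * h))" for k
  let ?S = "slotted_schedule N q"
  have "q k < n" for k
    using assms(1-3) mod_less_divisor[of "2 * h" k] unfolding q_def
    by (cases "k < h"; cases "k < 2 * h"; simp; linarith)
  then have S: "?S \<in> \<S>"
    using slotted_schedule_nonpreemptive assms(4) by blast
  have slot: "\<exists>k. k < 2 * h \<and> q k = p" if "p < 2 * h" for p
  proof (cases "b \<le> p \<and> p < b + h")
    case True
    then show ?thesis using assms(3) that
      by (intro exI[of _ "h + (p - b)"]) (auto simp: q_def)
  next
    case False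
    then show ?thesis using assms(3) that
      by (intro exI[of _ "p - (h - b)"]) (auto simp: q_def)
  qed
  have "delay_factor (adversary h b) ?S \<le> 1"
  proof (rule delay_factor_le_1)
    fix r assume "r \<in> set (adversary h b)"
    then consider (initial) p where "p < 2 * h"
        "r = \<lparr>page = p, arrival = 0, deadline = 2 * real h\<rparr>"
      | (repeated) p where "b \<le> p" "p < b + h"
        "r = \<lparr>page = p, arrival = real h, deadline = 3 * real h\<rparr>"
      | (stream) i where "2 * h \<le> i" "i < N"
        "r = \<lparr>page = 2 * h + i mod (2 * h), arrival = real i, deadline = real i + 1\<rparr>"
      unfolding adversary_defs N_def by auto
    then show "arrival r < deadline r \<and> satisfied_by ?S r (deadline r)"
    proof cases
      case initial
      then obtain k where "k < 2 * h" "q k = p" using slot by blast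
      then show ?thesis using initial assms(2)
        by (auto intro!: satisfied_by_slotted_schedule[of k] simp: N_def)
    next
      case repeated
      then show ?thesis using assms(2)
        by (auto intro!: satisfied_by_slotted_schedule[of "h + (p - b)"] simp: N_def q_def)
    next
      case stream
      then show ?thesis using assms(2)
        by (auto intro!: satisfied_by_slotted_schedule[of i] simp: q_def)
    qed
  qed
  then show ?thesis
    unfolding optimal_delay_factor_def using S by (meson INF_lower order_trans)
qed

section \<open>The lower bound for the algorithm\<close>

lemma sum_page_airtime_le:
  assumes "S \<in> schedules n" "a \<le> c" "finite P"
  shows "(\<Sum>p\<in>P. measure lebesgue (page_airtime S p \<inter> {a..<c})) \<le> c - a"
proof -
  have "(\<Sum>p\<in>P. measure lebesgue (page_airtime S p \<inter> {a..<c})) =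
      measure lebesgue (\<Union>p\<in>P. page_airtime S p \<inter> {a..<c})"
    using assms page_airtime_disjoint page_airtime_interval_lmeasurable
    by (intro measure_UNION'[symmetric]) (fastforce simp: pairwise_def disjnt_def)+
  also have "\<dots> \<le> measure lebesgue {a..<c}"
    using assms page_airtime_measurable
    by (intro measure_mono_fmeasurable) auto
  finally show ?thesis using assms(2) by simp
qed

text \<open>A volume argument: a smaller delay factor would force pairwise disjoint sets
  \<open>G i\<close> of total measure at least \<open>3 h / 2 + m^2\<close> into an interval of
  length \<open>5 h / 4 + m^2\<close>.\<close>

lemma delay_factor_adversary:
  assumes h: "0 < h" and b: "b = 0 \<or> b = h" and S: "S \<in> schedules n"
    and neglected: "(\<Sum>p\<in>{..<2 * h} - {b..<b + h}.
      measure lebesgue (page_airtime S p \<inter> {0..<real h})) \<le> real h / 2"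
  shows "ereal (real h / 4) \<le> delay_factor (adversary h b) S"
proof (rule ccontr)
  assume "\<not> ?thesis"
  then have delay: "delay_factor (adversary h b) S < ereal (real h / 4)" by simp
  define m where "m = 2 * h"
  define N where "N = m + m * m"
  define D where "D = real h / 4"
  \<comment> \<open>All requests would have to be satisfied before \<open>T\<close>. For the last
    ones of the stream this is due to the summand \<open>D\<close>; for those with slack
    \<open>m\<close>, the quadratic length of the stream makes \<open>T\<close> exceed
    \<open>h + D m\<close>.\<close>
  define T where "T = real N + D"
  let ?R = "{b..<b + h}"
  let ?w = "\<lambda>p. measure lebesgue (page_airtime S p \<inter> {0..<real h})"
  note served = airtime_of_satisfied_request[OF S _ _ delay]
  have T: "real h + D * real m \<le> T" "real h \<le> T"
    using h unfolding T_def N_def D_def m_def by (auto simp: field_simps)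
  \<comment> \<open>An index below \<open>m\<close> stands for a page of the two halves, any other
    for the stream request arriving at time \<open>i\<close>.\<close>
  define G where "G i = (if i < m then page_airtime S i \<inter> {real h..<T}
    else page_airtime S (m + i mod m) \<inter> {real i..<real i + D})" for i
  have G: "G i \<in> lmeasurable" for i
    unfolding G_def by (simp add: page_airtime_interval_lmeasurable[OF S])
  have G_stream: "1 \<le> measure lebesgue (G i)" if "m \<le> i" "i < N" for i
  proof -
    let ?r = "\<lparr>page = m + i mod m, arrival = real i, deadline = real i + 1\<rparr>"
    have "?r \<in> set (adversary h b)"
      using that unfolding adversary_defs N_def m_def by auto
    from served[OF this, of "real i + D"] show ?thesis
      using that by (simp add: G_def D_def)
  qed
  have G_repeated: "1 \<le> measure lebesgue (G p)" if "p \<in> ?R" for p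
  proof -
    let ?r = "\<lparr>page = p, arrival = real h, deadline = 3 * real h\<rparr>"
    have "?r \<in> set (adversary h b)"
      using that unfolding adversary_defs by auto
    from served[OF this, of T] show ?thesis
      using that h b T by (auto simp: G_def D_def m_def)
  qed
  \<comment> \<open>Work done before time \<open>h\<close> still counts for an initial request, so
    only the remainder is owed afterwards.\<close>
  have G_neglected: "1 - ?w p \<le> measure lebesgue (G p)" if "p < m" for p
  proof -
    let ?r = "\<lparr>page = p, arrival = 0, deadline = 2 * real h\<rparr>"
    have "?r \<in> set (adversary h b)"
      using that unfolding adversary_defs m_def by auto
    from served[OF this, of T] have "1 \<le> measure lebesgue (page_airtime S p \<inter> {0..<T})"
      using h T by (auto simp: D_def m_def)
    also have "page_airtime S p \<inter> {0..<T} = (page_airtime S p \<inter> {0..<real h}) \<union> G p"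
      using that T by (auto simp: G_def)
    also have "measure lebesgue \<dots> \<le> ?w p + measure lebesgue (G p)"
      using G page_airtime_interval_lmeasurable[OF S] by (intro measure_Un_le) auto
    finally show ?thesis by simp
  qed
  have disj: "G i \<inter> G j = {}" if "i < j" for i j
  proof (cases "m \<le> i \<and> i mod m = j mod m")
    case True
    \<comment> \<open>Stream requests for the same page arrive at least \<open>m = 2 h\<close>
      apart, while their windows have length only \<open>h / 4\<close>.\<close>
    then have "m \<le> j - i"
      using that by (metis dvd_imp_le less_imp_le mod_eq_dvd_iff_nat zero_less_diff)
    then have "real i + D \<le> real j"
      using that unfolding D_def m_def by linarith
    then show ?thesis
      using True that by (auto simp: G_def)
  next
    case False
    have "(if i < m then i else m + i mod m) \<noteq> (if j < m then j else m + j mod m)"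
      using False that by auto
    from page_airtime_disjoint[OF this, of S] show ?thesis
      by (auto simp: G_def split: if_splits)
  qed
  have G_sub: "G i \<subseteq> {real h..<T}" if "i < N" for i
    using that unfolding G_def T_def m_def by auto
  have split: "{..<N} = ?R \<union> ({..<m} - ?R) \<union> {m..<N}"
    using b unfolding N_def m_def by auto
  have card: "card ({..<m} - ?R) = h"
    using b unfolding m_def by (subst card_Diff_subset) auto
  have "real h + (real h - real h / 2) + real (m * m)
      \<le> (\<Sum>p\<in>?R. 1) + (\<Sum>p\<in>{..<m} - ?R. 1 - ?w p) + (\<Sum>i\<in>{m..<N}. 1)"
    using neglected card by (simp add: sum_subtractf m_def N_def)
  also have "\<dots> \<le> (\<Sum>p\<in>?R. measure lebesgue (G p)) + (\<Sum>p\<in>{..<m} - ?R. measure lebesgue (G p))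
      + (\<Sum>i\<in>{m..<N}. measure lebesgue (G i))"
    using G_repeated G_neglected G_stream by (intro add_mono sum_mono) auto
  also have "\<dots> = (\<Sum>i<N. measure lebesgue (G i))"
    unfolding split using b
    by (subst sum.union_disjoint, simp, simp, force simp: m_def)+ simp
  also have "\<dots> = measure lebesgue (\<Union>i<N. G i)"
    using G disj by (intro measure_UNION'[symmetric])
      (auto simp: pairwise_def disjnt_def, metis disjoint_iff linorder_neqE_nat)
  also have "\<dots> \<le> measure lebesgue {real h..<T}"
    using G G_sub by (intro measure_mono_fmeasurable) auto
  also have "\<dots> = real h + real (m * m) + real h / 4"
    using T(2) by (simp add: T_def N_def D_def m_def)
  finally show False using h by simp
qed

theorem theorem3p1:
  "\<exists>C::real. C > 0 \<and>
     (\<exists>N::nat. \<forall>n\<ge>N. \<forall>\<S>\<in>{schedules n, nonpreemptive_schedules n}.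
        \<forall>A. online_algorithm n \<S> A \<longrightarrow>
          (\<exists>\<sigma>. request_sequence n \<sigma> \<and>
               delay_factor \<sigma> (A \<sigma>) \<ge> ereal (C * real n) * optimal_delay_factor \<S> \<sigma>))"
proof -
  have "\<exists>\<sigma>. request_sequence n \<sigma> \<and>
      delay_factor \<sigma> (A \<sigma>) \<ge> ereal (1 / 32 * real n) * optimal_delay_factor \<S> \<sigma>"
    if n: "4 \<le> n" and \<S>: "\<S> \<in> {schedules n, nonpreemptive_schedules n}"
      and A: "online_algorithm n \<S> A" for n \<S> A
  proof -
    define h where "h = n div 4"
    \<comment> \<open>The bound \<open>n \<le> 8 * h\<close> turns \<open>h / 4\<close> into
      \<open>n / 32\<close>, hence the constant.\<close>
    have h: "0 < h" "4 * h \<le> n" "n \<le> 8 * h"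
      using n unfolding h_def by presburger+
    have sub: "nonpreemptive_schedules n \<subseteq> \<S>" "\<S> \<subseteq> schedules n"
      using \<S> by (auto simp: nonpreemptive_schedules_def)
    \<comment> \<open>The neglected half is read off the run on the initial requests alone, so the
      choice of \<open>b\<close> is not circular; being online carries the bound over to the run on
      the full sequence.\<close>
    let ?S\<^sub>0 = "A (initial_requests h)"
    let ?w = "\<lambda>p. measure lebesgue (page_airtime ?S\<^sub>0 p \<inter> {0..<real h})"
    have S\<^sub>0: "?S\<^sub>0 \<in> schedules n"
      using A sub(2) request_sequence_initial_requests[OF h(2)] unfolding online_algorithm_def by auto
    have "(\<Sum>p<2 * h. ?w p) \<le> real h"
      using sum_page_airtime_le[OF S\<^sub>0, of 0 "real h" "{..<2 * h}"] by simp
    moreover have "(\<Sum>p<2 * h. ?w p) = (\<Sum>p<h. ?w p) + (\<Sum>p\<in>{h..<2 * h}. ?w p)"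
      unfolding lessThan_atLeast0 by (rule sum.atLeastLessThan_concat[symmetric]) auto
    ultimately have "(\<Sum>p<h. ?w p) + (\<Sum>p\<in>{h..<2 * h}. ?w p) \<le> real h"
      by simp
    then have "(\<Sum>p<h. ?w p) \<le> real h / 2 \<or> (\<Sum>p\<in>{h..<2 * h}. ?w p) \<le> real h / 2"
      by linarith
    moreover have "{..<2 * h} - {h..<h + h} = {..<h}" "{..<2 * h} - {0..<0 + h} = {h..<2 * h}"
      by auto
    ultimately obtain b where b: "b = 0 \<or> b = h"
      "(\<Sum>p\<in>{..<2 * h} - {b..<b + h}. ?w p) \<le> real h / 2"
      by metis
    let ?\<sigma> = "adversary h b"
    have \<sigma>: "request_sequence n ?\<sigma>"
      using request_sequence_adversary h b(1) by auto
    have S: "A ?\<sigma> \<in> schedules n"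
      using A sub(2) \<sigma> unfolding online_algorithm_def by auto
    have "A ?\<sigma> t = ?S\<^sub>0 t" if "t < real h" for t
      using A \<sigma> request_sequence_initial_requests[OF h(2)] filter_adversary[OF that, of b]
      unfolding online_algorithm_def by blast
    then have "page_airtime (A ?\<sigma>) p \<inter> {0..<real h} = page_airtime ?S\<^sub>0 p \<inter> {0..<real h}" for p
      by (auto simp: page_airtime_def)
    then have "ereal (real h / 4) \<le> delay_factor ?\<sigma> (A ?\<sigma>)"
      using delay_factor_adversary[OF h(1) b(1) S] b(2) by simp
    moreover have "ereal (1 / 32 * real n) * optimal_delay_factor \<S> ?\<sigma> \<le> ereal (1 / 32 * real n) * 1"
      using optimal_delay_factor_adversary[OF h(2,1) b(1) sub(1)] by (intro ereal_mult_left_mono) auto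
    moreover have "ereal (1 / 32 * real n) * 1 \<le> ereal (real h / 4)"
      using h(3) by simp
    ultimately show ?thesis
      using \<sigma> by (meson order_trans)
  qed
  then show ?thesis
    by (intro exI[of _ "1 / 32"] conjI exI[of _ 4]) auto
qed

end
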